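(* Let $X$ be a finite metric space whose distance matrix $D$ is invertible. Then $X$ admits a microscopic weighting if and only if $\operatorname{con}(D)\neq\infty$. If so, then the microscopic weighting is the unique gauging for $D$.
   Context: Let $X=\{x_1,\dots,x_n\}$ be a finite metric space with metric $d$. Its distance matrix is $D=(d(x_i,x_j))_{i,j}$. For $t>0$, its similarity matrix at scale $t$ is $Z(t)=(e^{-t d(x_i,x_j)})_{i,j}$. Write $\mathbf{1}=(1,\dots,1)^{\mathrm T}\in\mathbb{R}^n$. For all sufficiently small $t>0$, $Z(t)$ is invertible; put $\mathbf{w}(t)=Z(t)^{-1}\mathbf{1}$. $X$ admits a microscopic weighting if $\widehat{\mathbf{w}}:=\lim_{t\to0^+}\mathbf{w}(t)$ exists componentwise in $\mathbb{R}^n$; then $\widehat{\mathbf{w}}$ is the microscopic weighting. A gauging for a symmetric real $n\times n$ matrix $A$ is a vector $\mathbf{v}\in\mathbb{R}^n$ with $\mathbf{1}^{\mathrm T}\mathbf{v}=1$ and $A\mathbf{v}=c\mathbf{1}$ for some $c\in\mathbb{R}$. All gaugings of $A$ have the same $c$; the concentration $\operatorname{con}(A)\in\mathbb{R}\cup\{\infty\}$ is this $c$ if a gauging exists, and $\infty$ if $A$ has no gauging. *)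

theory Defs
  imports "HOL-Analysis.Analysis"
begin

text \<open>A finite metric space \<open>X = {x\<^sub>1, \<dots>, x\<^sub>n}\<close> is given by a metric \<open>d\<close> on \<open>X\<close> together
  with an enumeration \<open>x\<close> of \<open>X\<close> by a finite index type; the index type has \<open>n\<close> elements
  and \<open>n \<ge> 1\<close>. The vector \<open>(1, \<dots>, 1)\<close> is the library constant \<open>1\<close> of \<open>real ^ 'n\<close>.\<close>

definition distance_matrix :: "('a \<Rightarrow> 'a \<Rightarrow> real) \<Rightarrow> ('n::finite \<Rightarrow> 'a) \<Rightarrow> real ^ 'n ^ 'n" where
  "distance_matrix d x = (\<chi> i j. d (x i) (x j))"

definition similarity_matrix ::
    "('a \<Rightarrow> 'a \<Rightarrow> real) \<Rightarrow> ('n::finite \<Rightarrow> 'a) \<Rightarrow> real \<Rightarrow> real ^ 'n ^ 'n" where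
  "similarity_matrix d x t = (\<chi> i j. exp (- t * d (x i) (x j)))"

text \<open>\<open>matrix_inv\<close> is unspecified at singular matrices. The similarity matrix of a finite
  metric space is invertible for all sufficiently small \<open>t > 0\<close>, so this does not affect
  the limit below.\<close>

definition weighting ::
    "('a \<Rightarrow> 'a \<Rightarrow> real) \<Rightarrow> ('n::finite \<Rightarrow> 'a) \<Rightarrow> real \<Rightarrow> real ^ 'n" where
  "weighting d x t = matrix_inv (similarity_matrix d x t) *v 1"

definition admits_microscopic_weighting ::
    "('a \<Rightarrow> 'a \<Rightarrow> real) \<Rightarrow> ('n::finite \<Rightarrow> 'a) \<Rightarrow> bool" where
  "admits_microscopic_weighting d x \<longleftrightarrow> (\<exists>w. (weighting d x \<longlongrightarrow> w) (at_right 0))"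

definition microscopic_weighting ::
    "('a \<Rightarrow> 'a \<Rightarrow> real) \<Rightarrow> ('n::finite \<Rightarrow> 'a) \<Rightarrow> real ^ 'n" where
  "microscopic_weighting d x = Lim (at_right 0) (weighting d x)"

text \<open>Gaugings and concentration are meant for symmetric matrices: there the constant \<open>c\<close>
  does not depend on the gauging, so the description in \<open>con\<close> is proper
  (lemma \<open>con_eq\<close>).\<close>

definition is_gauging :: "real ^ 'n ^ 'n \<Rightarrow> real ^ 'n \<Rightarrow> bool" where
  "is_gauging A v \<longleftrightarrow> 1 \<bullet> v = 1 \<and> (\<exists>c. A *v v = c *\<^sub>R 1)"

definition con :: "real ^ 'n ^ 'n \<Rightarrow> ereal" where
  "con A = (if \<exists>v. is_gauging A v
            then ereal (THE c. \<exists>v. is_gauging A v \<and> A *v v = c *\<^sub>R 1)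
            else \<infinity>)"

lemma gauging_constant_unique:
  fixes A :: "real ^ 'n ^ 'n"
  assumes "transpose A = A"
    and "is_gauging A v" "A *v v = c *\<^sub>R 1"
    and "is_gauging A v'" "A *v v' = c' *\<^sub>R 1"
  shows "c = c'"
proof -
  have "(A *v v) \<bullet> v' = v \<bullet> (A *v v')"
    using assms(1) by (metis dot_lmul_matrix vector_transpose_matrix)
  with assms show ?thesis
    by (simp add: is_gauging_def inner_commute)
qed

lemma con_eq:
  fixes A :: "real ^ 'n ^ 'n"
  assumes "transpose A = A" and "is_gauging A v" and "A *v v = c *\<^sub>R 1"
  shows "con A = ereal c"
proof -
  have "(THE c. \<exists>v. is_gauging A v \<and> A *v v = c *\<^sub>R 1) = c"
    using assms gauging_constant_unique by (intro the_equality) blast+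
  then show ?thesis
    using assms(2) by (auto simp: con_def)
qed

end

theory Submission
  imports Defs "HOL-Complex_Analysis.Complex_Analysis"
begin

text \<open>Write \<open>Z(t) = J - t A(t)\<close> with \<open>J\<close> the all-ones matrix, so that \<open>A(t) \<rightarrow> D\<close>, and let
  \<open>u(t)\<close> solve \<open>A(t) u(t) = 1\<close>; by Cramer's rule \<open>u(t) \<rightarrow> u = D\<^sup>-\<^sup>1 1\<close>. Then
  \<open>Z(t) u(t) = (1 \<bullet> u(t) - t) 1\<close>, whence \<open>(1 \<bullet> u(t) - t) w(t) = u(t)\<close> whenever \<open>Z(t)\<close> is
  invertible. That is so for arbitrarily small \<open>t > 0\<close>, because \<open>det Z(t)\<close> extends to an entire
  function which tends to \<open>1\<close> along the positive real axis. Hence a limit \<open>w\<close> of the weightings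
  satisfies \<open>(1 \<bullet> u) w = u\<close>. Conversely, if \<open>1 \<bullet> u \<noteq> 0\<close>, then \<open>Z(t)\<close> is invertible for all
  small \<open>t > 0\<close> and \<open>w(t)\<close> converges to \<open>u / (1 \<bullet> u)\<close>, which is the only gauging of \<open>D\<close>.\<close>

lemma tendsto_det:
  fixes A :: "'b \<Rightarrow> 'a::{real_normed_field} ^ 'n ^ 'n"
  assumes "\<And>i j. ((\<lambda>t. A t $ i $ j) \<longlongrightarrow> B $ i $ j) F"
  shows "((\<lambda>t. det (A t)) \<longlongrightarrow> det B) F"
  unfolding det_def by (intro tendsto_intros assms)

text \<open>Determinant quotients, rather than \<open>matrix_inv\<close>, so that entrywise
  convergence of the matrices passes directly to the solutions.\<close>

definition cramer_solution :: "'a::field ^ 'n ^ 'n \<Rightarrow> 'a ^ 'n \<Rightarrow> 'a ^ 'n" where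
  "cramer_solution A b = (\<chi> k. det (\<chi> i j. if j = k then b $ i else A $ i $ j) / det A)"

lemma mult_cramer_solution:
  fixes A :: "'a::field ^ 'n ^ 'n"
  assumes "det A \<noteq> 0"
  shows "A *v cramer_solution A b = b"
  using cramer[OF assms] by (simp add: cramer_solution_def)

lemma tendsto_cramer_solution:
  fixes A :: "'b \<Rightarrow> 'a::{real_normed_field} ^ 'n ^ 'n"
  assumes "\<And>i j. ((\<lambda>t. A t $ i $ j) \<longlongrightarrow> B $ i $ j) F" and "det B \<noteq> 0"
  shows "((\<lambda>t. cramer_solution (A t) b) \<longlongrightarrow> cramer_solution B b) F"
  unfolding cramer_solution_def
  by (intro tendsto_vec_lambda tendsto_divide tendsto_det) (use assms in auto)

lemma rank_one_update_mult:
  fixes A :: "real ^ 'n ^ 'n"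
  shows "(\<chi> i j. 1 - t * A $ i $ j) *v w = (1 \<bullet> w) *\<^sub>R 1 - t *\<^sub>R (A *v w)"
  by (simp add: vec_eq_iff matrix_vector_mult_def inner_vec_def left_diff_distrib
      sum_subtractf sum_distrib_left mult.assoc)

lemma matrix_inv_mult_cancel:
  fixes A :: "'a::field ^ 'n ^ 'n"
  assumes "invertible A"
  shows "matrix_inv A *v (A *v v) = v"
proof -
  have "matrix_inv A ** A = mat 1"
    using assms someI_ex[of "\<lambda>B. A ** B = mat 1 \<and> B ** A = mat 1"]
    unfolding invertible_def matrix_inv_def by blast
  then show ?thesis
    by (simp add: matrix_vector_mul_assoc)
qed

lemma rank_one_update_inverse_one:
  fixes A :: "real ^ 'n ^ 'n"
  defines "Z t \<equiv> \<chi> i j. 1 - t * A $ i $ j"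
  assumes "A *v u = 1" and "invertible (Z t)"
  shows "(1 \<bullet> u - t) *\<^sub>R (matrix_inv (Z t) *v 1) = u"
proof -
  have "Z t *v u = (1 \<bullet> u - t) *\<^sub>R 1"
    using assms(2) by (simp add: Z_def rank_one_update_mult scaleR_left_diff_distrib)
  then have "u = matrix_inv (Z t) *v ((1 \<bullet> u - t) *\<^sub>R 1)"
    using matrix_inv_mult_cancel[OF assms(3)] by metis
  then show ?thesis
    by (simp add: matrix_vector_mult_scaleR)
qed

text \<open>A kernel vector \<open>w\<close> satisfies \<open>t w = (1 \<bullet> w) u\<close>.
  Pairing with \<open>1\<close> gives \<open>(1 \<bullet> w) (t - 1 \<bullet> u) = 0\<close>, so
  \<open>1 \<bullet> w = 0\<close> and then \<open>w = 0\<close>.\<close>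

lemma rank_one_update_invertible:
  fixes A :: "real ^ 'n ^ 'n"
  assumes "invertible A" and "A *v u = 1" and "t \<noteq> 0" and "1 \<bullet> u \<noteq> t"
  shows "invertible (\<chi> i j. 1 - t * A $ i $ j :: real ^ 'n ^ 'n)"
proof -
  have "w = 0" if "(\<chi> i j. 1 - t * A $ i $ j :: real ^ 'n ^ 'n) *v w = 0" for w
  proof -
    have "A *v (t *\<^sub>R w) = A *v ((1 \<bullet> w) *\<^sub>R u)"
      using that assms(2) by (simp add: rank_one_update_mult matrix_vector_mult_scaleR)
    then have eq: "t *\<^sub>R w = (1 \<bullet> w) *\<^sub>R u"
      using matrix_inv_mult_cancel[OF assms(1)] by metis
    then have "1 \<bullet> (t *\<^sub>R w) = 1 \<bullet> ((1 \<bullet> w) *\<^sub>R u)"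
      by simp
    then have "1 \<bullet> w = 0"
      using assms(4) by (simp add: mult.commute)
    with eq assms(3) show ?thesis
      by simp
  qed
  then show ?thesis
    by (simp add: invertible_left_inverse matrix_left_invertible_ker)
qed

text \<open>Invertibility at arbitrarily small scales is enough to identify a limit of the
  weightings that is already known to exist.\<close>

lemma similarity_matrix_frequently_invertible:
  fixes x :: "'n::finite \<Rightarrow> 'a"
  assumes "\<And>i. d (x i) (x i) = 0" and "\<And>i j. i \<noteq> j \<Longrightarrow> d (x i) (x j) > 0"
  shows "\<exists>\<^sub>F t in at_right 0. invertible (similarity_matrix d x t)"
proof (rule ccontr)
  define f :: "complex \<Rightarrow> complex"
    where "f z = det (\<chi> i j. exp (- z * d (x i) (x j)) :: complex ^ 'n ^ 'n)" for z
  have hol: "f holomorphic_on UNIV"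
    unfolding f_def det_def by (auto intro!: holomorphic_intros)
  have f_real: "f (of_real t) = of_real (det (similarity_matrix d x t))" for t
    by (simp add: f_def det_def similarity_matrix_def exp_minus flip: exp_of_real)
  assume "\<not> ?thesis"
  then obtain e where e: "e > 0" "\<And>t. 0 < t \<Longrightarrow> t < e \<Longrightarrow> det (similarity_matrix d x t) = 0"
    by (auto simp: frequently_def eventually_at_right_field invertible_det_nz)
  have "f z = 0" for z
  \<comment> \<open>The zeros in the interval accumulate at \<open>0\<close>, so the identity
    theorem applies.\<close>
  proof (rule analytic_continuation[OF hol, where U = "of_real ` {0<..<e}" and \<xi> = 0])
    have "(0::real) islimpt {0<..<e}"
      using e(1) by (simp add: islimpt_greaterThanLessThan1)
    then have "\<forall>r>0. \<exists>t\<in>{0<..<e}. t \<noteq> 0 \<and> dist t 0 < r"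
      by (simp add: islimpt_approachable)
    then show "(0::complex) islimpt of_real ` {0<..<e}"
      by (simp add: islimpt_approachable)
  qed (use e f_real in auto)
  \<comment> \<open>For large \<open>t\<close> the off-diagonal entries decay, so the determinant
    cannot vanish on the whole real line.\<close>
  moreover have "((\<lambda>t. det (similarity_matrix d x t)) \<longlongrightarrow> det (mat 1 :: real ^ 'n ^ 'n)) at_top"
  proof (rule tendsto_det)
    fix i j
    show "((\<lambda>t. similarity_matrix d x t $ i $ j) \<longlongrightarrow> (mat 1 :: real ^ 'n ^ 'n) $ i $ j) at_top"
    proof (cases "i = j")
      case False
      then have "((\<lambda>t. exp (- (d (x i) (x j) * t))) \<longlongrightarrow> 0) at_top"
        using assms(2)[of i j] by real_asymp
      with False show ?thesis
        by (simp add: similarity_matrix_def mat_def mult.commute)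
    qed (simp add: similarity_matrix_def mat_def assms(1))
  qed
  ultimately show False
    using f_real by (simp add: tendsto_const_iff)
qed

text \<open>This is \<open>A(t)\<close> in the outline above.\<close>

definition difference_quotient_matrix ::
    "('a \<Rightarrow> 'a \<Rightarrow> real) \<Rightarrow> ('n::finite \<Rightarrow> 'a) \<Rightarrow> real \<Rightarrow> real ^ 'n ^ 'n" where
  "difference_quotient_matrix d x t = (\<chi> i j. (1 - exp (- t * d (x i) (x j))) / t)"

lemma similarity_matrix_eq:
  assumes "t \<noteq> 0"
  shows "similarity_matrix d x t = (\<chi> i j. 1 - t * difference_quotient_matrix d x t $ i $ j)"
  using assms by (simp add: similarity_matrix_def difference_quotient_matrix_def vec_eq_iff)

lemma tendsto_difference_quotient_matrix:
  "((\<lambda>t. difference_quotient_matrix d x t $ i $ j) \<longlongrightarrow> distance_matrix d x $ i $ j) (at_right 0)"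
proof -
  have "((\<lambda>t. (1 - exp (- t * a)) / t) \<longlongrightarrow> a) (at_right 0)" for a :: real
    by real_asymp
  then show ?thesis
    by (simp add: difference_quotient_matrix_def distance_matrix_def)
qed

text \<open>By injectivity of \<open>A\<close>, a gauging with constant \<open>c\<close> is
  \<open>c u\<close>, and normalisation gives \<open>c (1 \<bullet> u) = 1\<close>. The
  division-free form also covers \<open>1 \<bullet> u = 0\<close>: both sides then fail, since
  \<open>u \<noteq> 0\<close>.\<close>

lemma is_gauging_iff:
  fixes A :: "real ^ 'n ^ 'n"
  assumes "invertible A" and "A *v u = 1"
  shows "is_gauging A v \<longleftrightarrow> (1 \<bullet> u) *\<^sub>R v = u"
proof
  assume "is_gauging A v"
  then obtain c where c: "1 \<bullet> v = 1" "A *v v = A *v (c *\<^sub>R u)"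
    using assms(2) by (auto simp: is_gauging_def matrix_vector_mult_scaleR)
  then have v: "v = c *\<^sub>R u"
    using matrix_inv_mult_cancel[OF assms(1)] by metis
  with c(1) have "c * (1 \<bullet> u) = 1"
    by simp
  with v show "(1 \<bullet> u) *\<^sub>R v = u"
    by (simp add: mult.commute)
next
  assume v: "(1 \<bullet> u) *\<^sub>R v = u"
  have "u \<noteq> 0"
    using assms(2) by auto
  with v have "1 \<bullet> u \<noteq> 0"
    by auto
  with v have "v = (1 / (1 \<bullet> u)) *\<^sub>R u"
    by (metis divide_self_if mult.commute scaleR_one scaleR_scaleR times_divide_eq_left mult_1)
  with \<open>1 \<bullet> u \<noteq> 0\<close> assms(2) show "is_gauging A v"
    by (auto simp: is_gauging_def matrix_vector_mult_scaleR)
qed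

text \<open>Stated for every \<open>w\<close>, this yields existence of the limit, its value, and
  uniqueness of the gauging through uniqueness of limits.\<close>

lemma tendsto_weighting_iff:
  fixes x :: "'n::finite \<Rightarrow> 'a"
  assumes zero: "\<And>i. d (x i) (x i) = 0" and pos: "\<And>i j. i \<noteq> j \<Longrightarrow> d (x i) (x j) > 0"
    and inv: "invertible (distance_matrix d x)"
  shows "(weighting d x \<longlongrightarrow> w) (at_right 0) \<longleftrightarrow> is_gauging (distance_matrix d x) w"
proof -
  let ?D = "distance_matrix d x" and ?A = "difference_quotient_matrix d x"
  define u where "u t = cramer_solution (?A t) 1" for t
  define u0 where "u0 = cramer_solution ?D 1"
  have D: "det ?D \<noteq> 0"
    using inv by (simp add: invertible_det_nz)
  have u0: "?D *v u0 = 1"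
    unfolding u0_def by (rule mult_cramer_solution[OF D])
  have lim_u: "(u \<longlongrightarrow> u0) (at_right 0)"
    unfolding u_def u0_def by (intro tendsto_cramer_solution tendsto_difference_quotient_matrix D)
  then have lim_s: "((\<lambda>t. 1 \<bullet> u t - t) \<longlongrightarrow> 1 \<bullet> u0) (at_right 0)"
    by (auto intro!: tendsto_eq_intros)
  have t_pos: "\<forall>\<^sub>F t in at_right 0. (t::real) > 0"
    by (simp add: eventually_at_right_less)
  have "\<forall>\<^sub>F t in at_right 0. det (?A t) \<noteq> 0"
    using tendsto_det[OF tendsto_difference_quotient_matrix] D by (rule tendsto_imp_eventually_ne)
  then have A_inv: "\<forall>\<^sub>F t in at_right 0. invertible (?A t) \<and> ?A t *v u t = 1"
    by eventually_elim (simp add: u_def mult_cramer_solution invertible_det_nz)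
  \<comment> \<open>The premise excludes singular similarity matrices, where
    \<open>matrix_inv\<close> is unspecified.\<close>
  have key: "\<forall>\<^sub>F t in at_right 0. invertible (similarity_matrix d x t) \<longrightarrow>
      (1 \<bullet> u t - t) *\<^sub>R weighting d x t = u t"
    using A_inv t_pos
    by eventually_elim
      (auto simp: weighting_def similarity_matrix_eq intro: rank_one_update_inverse_one)
  show ?thesis
    unfolding is_gauging_iff[OF inv u0]
  proof
    assume "(weighting d x \<longlongrightarrow> w) (at_right 0)"
    with lim_s lim_u
    have lim: "((\<lambda>t. (1 \<bullet> u t - t) *\<^sub>R weighting d x t - u t) \<longlongrightarrow> (1 \<bullet> u0) *\<^sub>R w - u0) (at_right 0)"
      by (intro tendsto_intros)
    \<comment> \<open>The difference vanishes at every small scale with invertible similarity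
      matrix, hence frequently, which rules out a nonzero limit.\<close>
    have freq: "\<exists>\<^sub>F t in at_right 0. (1 \<bullet> u t - t) *\<^sub>R weighting d x t - u t = 0"
      using frequently_eventually_frequently[OF similarity_matrix_frequently_invertible[of d x] key]
        zero pos by (auto elim!: frequently_elim1)
    show "(1 \<bullet> u0) *\<^sub>R w = u0"
    proof (rule ccontr)
      assume "(1 \<bullet> u0) *\<^sub>R w \<noteq> u0"
      then have "\<forall>\<^sub>F t in at_right 0. (1 \<bullet> u t - t) *\<^sub>R weighting d x t - u t \<noteq> 0"
        by (intro tendsto_imp_eventually_ne[OF lim]) simp
      with freq show False
        by (simp add: frequently_def)
    qed
  next
    assume w: "(1 \<bullet> u0) *\<^sub>R w = u0"
    have "u0 \<noteq> 0"
      using u0 by auto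
    with w have s: "1 \<bullet> u0 \<noteq> 0"
      by auto
    \<comment> \<open>Since \<open>1 \<bullet> u0 \<noteq> 0\<close>, the factor
      \<open>1 \<bullet> u t - t\<close> is eventually nonzero; this gives both invertibility of the
      similarity matrix and the right to divide.\<close>
    have "\<forall>\<^sub>F t in at_right 0. inverse (1 \<bullet> u t - t) *\<^sub>R u t = weighting d x t"
      using tendsto_imp_eventually_ne[OF lim_s s] A_inv t_pos key
    proof eventually_elim
      case (elim t)
      then have "invertible (similarity_matrix d x t)"
        using rank_one_update_invertible[of "?A t" "u t" t] by (simp add: similarity_matrix_eq)
      with elim have "u t = (1 \<bullet> u t - t) *\<^sub>R weighting d x t"
        by simp
      then have "inverse (1 \<bullet> u t - t) *\<^sub>R u t
          = inverse (1 \<bullet> u t - t) *\<^sub>R (1 \<bullet> u t - t) *\<^sub>R weighting d x t"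
        by (rule arg_cong)
      with elim(1) show ?case
        by simp
    qed
    moreover have "((\<lambda>t. inverse (1 \<bullet> u t - t) *\<^sub>R u t) \<longlongrightarrow> inverse (1 \<bullet> u0) *\<^sub>R u0) (at_right 0)"
      by (intro tendsto_scaleR tendsto_inverse lim_s lim_u s)
    moreover have "inverse (1 \<bullet> u0) *\<^sub>R u0 = inverse (1 \<bullet> u0) *\<^sub>R (1 \<bullet> u0) *\<^sub>R w"
      using w by simp
    then have "inverse (1 \<bullet> u0) *\<^sub>R u0 = w"
      using s by simp
    ultimately show "(weighting d x \<longlongrightarrow> w) (at_right 0)"
      using tendsto_cong by fastforce
  qed
qed

theorem theorem3p8:
  fixes X :: "'a set" and d :: "'a \<Rightarrow> 'a \<Rightarrow> real" and x :: "'n::finite \<Rightarrow> 'a"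
  assumes "Metric_space X d"
    and "bij_betw x UNIV X"
    and "invertible (distance_matrix d x)"
  shows "(admits_microscopic_weighting d x \<longleftrightarrow> con (distance_matrix d x) \<noteq> \<infinity>) \<and>
    (admits_microscopic_weighting d x \<longrightarrow>
      is_gauging (distance_matrix d x) (microscopic_weighting d x) \<and>
      (\<forall>v. is_gauging (distance_matrix d x) v \<longrightarrow> v = microscopic_weighting d x))"
proof -
  interpret Metric_space X d
    by (rule assms(1))
  have X: "x i \<in> X" for i
    using assms(2) by (auto simp: bij_betw_def)
  have "x i \<noteq> x j" if "i \<noteq> j" for i j
    using assms(2) that by (auto simp: bij_betw_def inj_def)
  then have lim_iff: "(weighting d x \<longlongrightarrow> w) (at_right 0) \<longleftrightarrow> is_gauging (distance_matrix d x) w" for w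
    using X by (intro tendsto_weighting_iff assms(3)) (auto simp: mdist_pos_less)
  have "microscopic_weighting d x = w" if "is_gauging (distance_matrix d x) w" for w
    unfolding microscopic_weighting_def using that lim_iff by (intro tendsto_Lim) auto
  then show ?thesis
    by (auto simp: admits_microscopic_weighting_def con_def lim_iff)
qed

end
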